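(* Suppose that the assumptions on outer-level functions, inner-level functions and bounded heterogeneity listed in the context hold. Let $\nabla\Phi_i(x)$ be the local hypergradient of node $i$ evaluated at $x\in\mathbb R^n$. Then $$\sum_{i=1}^m\|\nabla\Phi_i(x)-\nabla\Phi(x)\|^2\le b^2,$$ where $b^2=C_1b_f^2+C_2b_g^2$ with $C_1=4+4\frac{C_{g,x\theta}^2}{\mu_g^2}$ and $$C_2=4\Big(4\frac{C_{f,\theta}^2C_{g,x\theta}^2}{\mu_g^4}+4\frac{C_{f,\theta}^2}{\mu_g^2}+\frac{L_{f,x}^2}{\mu_g^2}+\frac{L_{f,\theta}^2C_{g,x\theta}^2}{\mu_g^4}+4\frac{C_{f,\theta}^2C_{g,x\theta}^2L_{g,\theta\theta}^2}{\mu_g^6}+4\frac{C_{f,\theta}^2L_{g,x\theta}^2}{\mu_g^4}\Big).$$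
   Context: **Setting.** Let $\mathcal V=\{1,\dots,m\}$ and, for $i\in\mathcal V$, $f_i,g_i:\mathbb R^n\times\mathbb R^p\to\mathbb R$. Put $\theta_i^*(x)=\arg\min_\theta g_i(x,\theta)$, $\Phi_i(x)=f_i(x,\theta_i^*(x))$, $\Phi=\frac1m\sum_{i=1}^m\Phi_i$. $\nabla_x,\nabla_\theta$ are partial gradients; $\nabla^2_{x\theta}g_i\in\mathbb R^{n\times p}$ and $\nabla^2_{\theta\theta}g_i$ are the Jacobian and Hessian. $\|\cdot\|$ is the Euclidean/spectral norm. **Outer-level functions.** With positive constants $L_{f,x},L_{f,\theta},C_{f,\theta}$, each $f_i$ satisfies: (i) $f_i$ is continuously differentiable; (ii) for any $\theta$, $\nabla_xf_i(\cdot,\theta)$ is $L_{f,x}$-Lipschitz in $x$, and for any $x$, $\nabla_\theta f_i(x,\cdot)$ is $L_{f,\theta}$-Lipschitz in $\theta$; (iii) $\|\nabla_\theta f_i(x,\theta_i^*(x))\|\le C_{f,\theta}$ for any $x$. **Inner-level functions.** With positive constants $\mu_g,L_{g,\theta},L_{g,x\theta},L_{g,\theta\theta},C_{g,x\theta}$, each $g_i$ satisfies: (i) for any $x$, $g_i(x,\cdot)$ is $\mu_g$-strongly convex, and $g_i$ is twice continuously differentiable; (ii) for any $x$, $\nabla_\theta g_i(x,\cdot)$ is $L_{g,\theta}$-Lipschitz in $\theta$; $\nabla^2_{x\theta}g_i(\cdot,\cdot)$ and $\nabla^2_{\theta\theta}g_i(\cdot,\cdot)$ are $L_{g,x\theta}$-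 and $L_{g,\theta\theta}$-Lipschitz; (iii) $\|\nabla^2_{x\theta}g_i(x,\theta)\|\le C_{g,x\theta}$ for all $x,\theta$. **Bounded heterogeneity.** With $\nabla_xf=\frac1m\sum_j\nabla_xf_j$, $\nabla_\theta f=\frac1m\sum_j\nabla_\theta f_j$, there are positive constants $b_f^2,b_g^2$ such that (i) $\sum_i\|\nabla_xf_i(x,\theta)-\nabla_xf(x,\theta)\|^2\le b_f^2$ and $\sum_i\|\nabla_\theta f_i(x,\theta)-\nabla_\theta f(x,\theta)\|^2\le b_f^2$ for all $x,\theta$; (ii) $\frac1m\sum_{i,j}\|\nabla_\theta g_i(x,\theta_j^*(x))-\nabla_\theta g_j(x,\theta_j^*(x))\|^2\le b_g^2$ for all $x$; (iii) $\frac1m\sum_{i,j}\|\nabla^2_{x\theta}g_i(x,\theta_j^*(x))-\nabla^2_{x\theta}g_j(x,\theta_j^*(x))\|^2\le b_g^2$ and $\frac1m\sum_{i,j}\|\nabla^2_{\theta\theta}g_i(x,\theta_j^*(x))-\nabla^2_{\theta\theta}g_j(x,\theta_j^*(x))\|^2\le b_g^2$ for all $x$.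
   Formalization: Adds the assumption that for any x, ∇_x f_i(x,·) is L_{f,x}-Lipschitz in θ; with ∇_x f_i Lipschitz only in x the inequality is false (e.g. f_1=f_2=sin(20x)sin(400θ), g_i=(θ−a_i)²/2, a_1=0, a_2=π/800). *)

theory Defs
  imports "HOL-Analysis.Analysis"
begin

definition grad :: "('a::real_inner \<Rightarrow> real) \<Rightarrow> 'a \<Rightarrow> 'a" where
  "grad F x = (THE D. GDERIV F x :> D)"

definition grad_x :: "(real^'n \<Rightarrow> real^'p \<Rightarrow> real) \<Rightarrow> real^'n \<Rightarrow> real^'p \<Rightarrow> real^'n" where
  "grad_x h x \<theta> = grad (\<lambda>x'. h x' \<theta>) x"

definition grad_\<theta> :: "(real^'n \<Rightarrow> real^'p \<Rightarrow> real) \<Rightarrow> real^'n \<Rightarrow> real^'p \<Rightarrow> real^'p" where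
  "grad_\<theta> h x \<theta> = grad (h x) \<theta>"

text \<open>The n-by-p Jacobian of the x-gradient with respect to \<theta>; its (a,b) entry is the
  second partial derivative in the a-th coordinate of x and the b-th coordinate of \<theta>.\<close>
definition jac_x\<theta> :: "(real^'n \<Rightarrow> real^'p \<Rightarrow> real) \<Rightarrow> real^'n \<Rightarrow> real^'p \<Rightarrow> real^'p^'n" where
  "jac_x\<theta> h x \<theta> = jacobian (\<lambda>\<theta>'. grad_x h x \<theta>') (at \<theta>)"

definition hess_\<theta>\<theta> :: "(real^'n \<Rightarrow> real^'p \<Rightarrow> real) \<Rightarrow> real^'n \<Rightarrow> real^'p \<Rightarrow> real^'p^'p" where
  "hess_\<theta>\<theta> h x \<theta> = jacobian (\<lambda>\<theta>'. grad_\<theta> h x \<theta>') (at \<theta>)"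

text \<open>The library norm on matrix types is the Frobenius norm, hence the explicit operator norm.\<close>
definition spectral_norm :: "real^'k^'l \<Rightarrow> real" where
  "spectral_norm A = onorm (\<lambda>v. A *v v)"

definition cont_diff :: "('a::real_normed_vector \<Rightarrow> 'b::real_normed_vector) \<Rightarrow> bool" where
  "cont_diff F \<longleftrightarrow>
     (\<exists>F' :: 'a \<Rightarrow> 'a \<Rightarrow>\<^sub>L 'b. (\<forall>z. (F has_derivative blinfun_apply (F' z)) (at z)) \<and>
        continuous_on UNIV F')"

definition twice_cont_diff :: "('a::real_normed_vector \<Rightarrow> 'b::real_normed_vector) \<Rightarrow> bool" where
  "twice_cont_diff F \<longleftrightarrow>
     (\<exists>F' :: 'a \<Rightarrow> 'a \<Rightarrow>\<^sub>L 'b. (\<forall>z. (F has_derivative blinfun_apply (F' z)) (at z)) \<and>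
        cont_diff F')"

definition strongly_convex :: "real \<Rightarrow> ('a::real_normed_vector \<Rightarrow> real) \<Rightarrow> bool" where
  "strongly_convex \<mu> F \<longleftrightarrow>
     (\<forall>u v t. 0 \<le> t \<and> t \<le> 1 \<longrightarrow>
        F (t *\<^sub>R u + (1 - t) *\<^sub>R v)
          \<le> t * F u + (1 - t) * F v - \<mu> / 2 * t * (1 - t) * (norm (u - v))\<^sup>2)"

definition inner_sol :: "(real^'n \<Rightarrow> real^'p \<Rightarrow> real) \<Rightarrow> real^'n \<Rightarrow> real^'p" where
  "inner_sol g x = (ARG_MIN (g x) \<theta>. True)"

definition local_obj ::
  "(real^'n \<Rightarrow> real^'p \<Rightarrow> real) \<Rightarrow> (real^'n \<Rightarrow> real^'p \<Rightarrow> real) \<Rightarrow> real^'n \<Rightarrow> real" where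
  "local_obj f g x = f x (inner_sol g x)"

definition global_obj ::
  "nat \<Rightarrow> (nat \<Rightarrow> real^'n \<Rightarrow> real^'p \<Rightarrow> real) \<Rightarrow> (nat \<Rightarrow> real^'n \<Rightarrow> real^'p \<Rightarrow> real)
     \<Rightarrow> real^'n \<Rightarrow> real" where
  "global_obj m f g x = 1 / real m * (\<Sum>i=1..m. local_obj (f i) (g i) x)"

definition avg_grad_x ::
  "nat \<Rightarrow> (nat \<Rightarrow> real^'n \<Rightarrow> real^'p \<Rightarrow> real) \<Rightarrow> real^'n \<Rightarrow> real^'p \<Rightarrow> real^'n" where
  "avg_grad_x m f x \<theta> = (1 / real m) *\<^sub>R (\<Sum>j=1..m. grad_x (f j) x \<theta>)"

definition avg_grad_\<theta> ::
  "nat \<Rightarrow> (nat \<Rightarrow> real^'n \<Rightarrow> real^'p \<Rightarrow> real) \<Rightarrow> real^'n \<Rightarrow> real^'p \<Rightarrow> real^'p" where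
  "avg_grad_\<theta> m f x \<theta> = (1 / real m) *\<^sub>R (\<Sum>j=1..m. grad_\<theta> (f j) x \<theta>)"

text \<open>Each partial gradient is Lipschitz only in its own variable here; this gives no
  Lipschitz bound on the x-gradient as a function of \<theta>, which has to be assumed separately.\<close>
definition outer_level ::
  "real \<Rightarrow> real \<Rightarrow> real \<Rightarrow> (real^'n \<Rightarrow> real^'p \<Rightarrow> real) \<Rightarrow> (real^'n \<Rightarrow> real^'p \<Rightarrow> real)
     \<Rightarrow> bool" where
  "outer_level Lfx Lf\<theta> Cf\<theta> f g \<longleftrightarrow>
     0 < Lfx \<and> 0 < Lf\<theta> \<and> 0 < Cf\<theta> \<and>
     cont_diff (\<lambda>(x, \<theta>). f x \<theta>) \<and>
     (\<forall>\<theta>. Lfx-lipschitz_on UNIV (\<lambda>x. grad_x f x \<theta>)) \<and>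
     (\<forall>x. Lf\<theta>-lipschitz_on UNIV (\<lambda>\<theta>. grad_\<theta> f x \<theta>)) \<and>
     (\<forall>x. norm (grad_\<theta> f x (inner_sol g x)) \<le> Cf\<theta>)"

definition inner_level ::
  "real \<Rightarrow> real \<Rightarrow> real \<Rightarrow> real \<Rightarrow> real \<Rightarrow> (real^'n \<Rightarrow> real^'p \<Rightarrow> real) \<Rightarrow> bool" where
  "inner_level \<mu>g Lg\<theta> Lgx\<theta> Lg\<theta>\<theta> Cgx\<theta> g \<longleftrightarrow>
     0 < \<mu>g \<and> 0 < Lg\<theta> \<and> 0 < Lgx\<theta> \<and> 0 < Lg\<theta>\<theta> \<and> 0 < Cgx\<theta> \<and>
     (\<forall>x. strongly_convex \<mu>g (g x)) \<and>
     twice_cont_diff (\<lambda>(x, \<theta>). g x \<theta>) \<and>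
     (\<forall>x. Lg\<theta>-lipschitz_on UNIV (\<lambda>\<theta>. grad_\<theta> g x \<theta>)) \<and>
     (\<forall>x \<theta> x' \<theta>'. spectral_norm (jac_x\<theta> g x \<theta> - jac_x\<theta> g x' \<theta>')
                      \<le> Lgx\<theta> * dist (x, \<theta>) (x', \<theta>')) \<and>
     (\<forall>x \<theta> x' \<theta>'. spectral_norm (hess_\<theta>\<theta> g x \<theta> - hess_\<theta>\<theta> g x' \<theta>')
                      \<le> Lg\<theta>\<theta> * dist (x, \<theta>) (x', \<theta>')) \<and>
     (\<forall>x \<theta>. spectral_norm (jac_x\<theta> g x \<theta>) \<le> Cgx\<theta>)"

definition bounded_heterogeneity ::
  "nat \<Rightarrow> real \<Rightarrow> real \<Rightarrow> (nat \<Rightarrow> real^'n \<Rightarrow> real^'p \<Rightarrow> real)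
     \<Rightarrow> (nat \<Rightarrow> real^'n \<Rightarrow> real^'p \<Rightarrow> real) \<Rightarrow> bool" where
  "bounded_heterogeneity m bf bg f g \<longleftrightarrow>
     0 < bf \<and> 0 < bg \<and>
     (\<forall>x \<theta>. (\<Sum>i=1..m. (norm (grad_x (f i) x \<theta> - avg_grad_x m f x \<theta>))\<^sup>2) \<le> bf\<^sup>2) \<and>
     (\<forall>x \<theta>. (\<Sum>i=1..m. (norm (grad_\<theta> (f i) x \<theta> - avg_grad_\<theta> m f x \<theta>))\<^sup>2) \<le> bf\<^sup>2) \<and>
     (\<forall>x. 1 / real m * (\<Sum>i=1..m. \<Sum>j=1..m.
        (norm (grad_\<theta> (g i) x (inner_sol (g j) x) - grad_\<theta> (g j) x (inner_sol (g j) x)))\<^sup>2)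
          \<le> bg\<^sup>2) \<and>
     (\<forall>x. 1 / real m * (\<Sum>i=1..m. \<Sum>j=1..m.
        (spectral_norm (jac_x\<theta> (g i) x (inner_sol (g j) x)
                          - jac_x\<theta> (g j) x (inner_sol (g j) x)))\<^sup>2) \<le> bg\<^sup>2) \<and>
     (\<forall>x. 1 / real m * (\<Sum>i=1..m. \<Sum>j=1..m.
        (spectral_norm (hess_\<theta>\<theta> (g i) x (inner_sol (g j) x)
                          - hess_\<theta>\<theta> (g j) x (inner_sol (g j) x)))\<^sup>2) \<le> bg\<^sup>2)"

end

theory Submission
  imports Defs
begin

text \<open>
  Fix \<open>x\<close>, write \<open>\<theta>\<^sub>i\<close> for the inner minimiser of node \<open>i\<close>, and \<open>J\<^sub>i\<close>, \<open>H\<^sub>i\<close> for its mixed Jacobian and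
  its Hessian. Differentiating the stationarity equation that determines \<open>\<theta>\<^sub>i\<close> shows that the gradient
  of the local objective is
  \<open>v\<^sub>i = \<nabla>\<^sub>xf\<^sub>i - M\<^sub>i \<nabla>\<^sub>\<theta>f\<^sub>i\<close> at \<open>(x, \<theta>\<^sub>i)\<close>, where \<open>M\<^sub>i = J\<^sub>i H\<^sub>i\<^sup>-\<^sup>1\<close> at \<open>(x, \<theta>\<^sub>i)\<close>
  (\<open>GDERIV_local_obj\<close>). This needs the minimiser to exist and to be differentiable
  (\<open>strongly_convex_attains_min\<close>, \<open>implicit_solution_has_derivative\<close>) and, since the implicit
  equation produces the \<open>x\<close>-derivative of \<open>\<nabla>\<^sub>\<theta>g\<^sub>i\<close> while \<open>J\<^sub>i\<close> is the \<open>\<theta>\<close>-derivative of \<open>\<nabla>\<^sub>xg\<^sub>i\<close>, the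
  symmetry of second derivatives (\<open>second_derivative_symmetric\<close>).

  The rest is an estimate of \<open>\<Sum>\<^sub>i |v\<^sub>i - v|\<^sup>2\<close> with \<open>v\<close> the mean of the \<open>v\<^sub>i\<close>. As the mean minimises the
  sum of squared distances, \<open>v\<close> may be replaced by any vector, hence the sum is at most the average
  over \<open>k\<close> of the sums \<open>\<Sum>\<^sub>i |v\<^sub>i - w\<^sub>k|\<^sup>2\<close> for suitable reference vectors \<open>w\<^sub>k\<close>. The two kinds of
  heterogeneity ask for two kinds of reference. The gradients of the \<open>f\<^sub>i\<close> are close to their
  average only when all of them are evaluated at one common point, and the curvature data of
  \<open>g\<^sub>i\<close> and \<open>g\<^sub>k\<close> are compared at the points \<open>\<theta>\<^sub>k\<close>. Therefore
  \<open>w\<^sub>k = \<nabla>\<^sub>xf - M\<^sub>k \<nabla>\<^sub>\<theta>f\<close>, where the averaged gradients are taken at \<open>(x, c)\<close> with \<open>c\<close> the mean of the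
  \<open>\<theta>\<^sub>i\<close>, and \<open>M\<^sub>k\<close> stays at \<open>(x, \<theta>\<^sub>k)\<close>.

  Then \<open>v\<^sub>i - w\<^sub>k\<close> is a sum of five terms: two come from moving \<open>\<nabla>\<^sub>xf\<^sub>i\<close> and \<open>\<nabla>\<^sub>\<theta>f\<^sub>i\<close> from \<open>\<theta>\<^sub>i\<close> to \<open>c\<close>, two
  from replacing them by their averages at \<open>c\<close>, and one is \<open>(M\<^sub>i - M\<^sub>k) \<nabla>\<^sub>\<theta>f\<^sub>i\<close>
  (\<open>solve_map_difference_sq_le\<close>). A Cauchy-Schwarz inequality for five terms would cost a factor
  5 instead of the 4 in \<open>C1\<close> and \<open>C2\<close>. The mean \<open>c\<close> pays for this: the squared distances from the
  \<open>\<theta>\<^sub>i\<close> to \<open>c\<close> sum to half of the average over \<open>k\<close> of \<open>\<Sum>\<^sub>i |\<theta>\<^sub>i - \<theta>\<^sub>k|\<^sup>2\<close> (\<open>sum_sq_dist_pairs\<close>), so the two moving terms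
  can be merged into one of four terms at the price of a factor 2 that this half absorbs.
  Finally strong convexity gives \<open>|\<theta>\<^sub>i - \<theta>\<^sub>k| \<le> |\<nabla>\<^sub>\<theta>g\<^sub>i(x, \<theta>\<^sub>k)| / \<mu>\<close>, and \<open>\<nabla>\<^sub>\<theta>g\<^sub>k\<close> vanishes at
  \<open>(x, \<theta>\<^sub>k)\<close>, so the distances between minimisers are controlled by the heterogeneity of \<open>\<nabla>\<^sub>\<theta>g\<close>.
\<close>

section \<open>Gradients and Jacobians\<close>

lemma GDERIV_unique:
  assumes "GDERIV F x :> D" "GDERIV F x :> E"
  shows "D = E"
proof -
  have "(\<lambda>h. inner h D) = (\<lambda>h. inner h E)"
    using assms unfolding gderiv_def by (rule has_derivative_unique)
  then show ?thesis
    by (metis vector_eq_ldot)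
qed

lemma grad_eqI: "GDERIV F x :> D \<Longrightarrow> grad F x = D"
  unfolding grad_def by (blast intro: the_equality GDERIV_unique)

text \<open>
  On a Euclidean space every derivative is represented by a vector (Riesz), namely the value of its
  adjoint at 1; so differentiability is enough for \<open>grad\<close> to be meaningful.
\<close>
lemma GDERIV_grad:
  fixes F :: "'a::euclidean_space \<Rightarrow> real"
  assumes "(F has_derivative F') (at x)"
  shows "GDERIV F x :> grad F x"
proof -
  have "inner h (adjoint F' 1) = F' h" for h
    using adjoint_works[OF has_derivative_linear[OF assms], of h 1] by simp
  then have "GDERIV F x :> adjoint F' 1"
    using assms by (simp add: gderiv_def)
  then show ?thesis
    by (simp only: grad_eqI)
qed

lemma inner_grad:
  fixes F :: "'a::euclidean_space \<Rightarrow> real"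
  assumes "(F has_derivative F') (at x)"
  shows "inner h (grad F x) = F' h"
  using has_derivative_unique[OF GDERIV_grad[OF assms, unfolded gderiv_def] assms] by meson

lemma jacobian_mult_vec:
  fixes F :: "real^'a \<Rightarrow> real^'b"
  assumes "(F has_derivative F') (at x)"
  shows "jacobian F (at x) *v h = F' h"
proof -
  have "(F has_derivative (\<lambda>h. jacobian F (at x) *v h)) (at x)"
    using assms jacobian_works differentiableI by blast
  from has_derivative_unique[OF this assms] show ?thesis by meson
qed

lemma has_derivative_left_section:
  assumes "((\<lambda>(x, \<theta>). h x \<theta>) has_derivative D) (at (x, \<theta>))"
  shows "((\<lambda>x'. h x' \<theta>) has_derivative (\<lambda>k. D (k, 0))) (at x)"
proof -
  have "((\<lambda>x'. (x', \<theta>)) has_derivative (\<lambda>k. (k, 0))) (at x)"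
    by (auto intro!: derivative_eq_intros)
  from has_derivative_compose[OF this assms] show ?thesis by simp
qed

lemma has_derivative_right_section:
  assumes "((\<lambda>(x, \<theta>). h x \<theta>) has_derivative D) (at (x, \<theta>))"
  shows "(h x has_derivative (\<lambda>k. D (0, k))) (at \<theta>)"
proof -
  have "((\<lambda>\<theta>'. (x, \<theta>')) has_derivative (\<lambda>k. (0, k))) (at \<theta>)"
    by (auto intro!: derivative_eq_intros)
  from has_derivative_compose[OF this assms] show ?thesis by simp
qed

lemma inner_grad_x:
  assumes "((\<lambda>(x, \<theta>). h x \<theta>) has_derivative D) (at (x, \<theta>))"
  shows "inner k (grad_x h x \<theta>) = D (k, 0)"
  unfolding grad_x_def by (rule inner_grad[OF has_derivative_left_section[OF assms]])

lemma inner_grad_\<theta>: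
  assumes "((\<lambda>(x, \<theta>). h x \<theta>) has_derivative D) (at (x, \<theta>))"
  shows "inner k (grad_\<theta> h x \<theta>) = D (0, k)"
  unfolding grad_\<theta>_def by (rule inner_grad[OF has_derivative_right_section[OF assms]])

lemma total_derivative_grads:
  assumes "((\<lambda>(x, \<theta>). h x \<theta>) has_derivative D) (at (x, \<theta>))"
  shows "D k = inner (fst k) (grad_x h x \<theta>) + inner (snd k) (grad_\<theta> h x \<theta>)"
proof -
  have "D k = D ((fst k, 0) + (0, snd k))" by simp
  also have "\<dots> = D (fst k, 0) + D (0, snd k)"
    using has_derivative_linear[OF assms] by (rule linear_add)
  finally show ?thesis
    using inner_grad_x[OF assms] inner_grad_\<theta>[OF assms] by simp
qed

section \<open>Symmetry of second derivatives\<close>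

text \<open>
  The second difference of \<open>F\<close> over the parallelogram spanned by \<open>t u\<close> and \<open>t v\<close> is a first
  difference in direction \<open>v\<close> of the \<open>t u\<close>-increment of \<open>F\<close>. The mean value theorem turns it into a difference of two
  values of \<open>F'\<close>, whose linearisation at \<open>z\<close> is \<open>t F'' u\<close>.
\<close>
lemma second_difference_estimate:
  fixes F :: "'a::real_normed_vector \<Rightarrow> real" and F' :: "'a \<Rightarrow> 'a \<Rightarrow>\<^sub>L real"
  assumes F: "\<And>y. (F has_derivative F' y) (at y)"
    and F': "(F' has_derivative F'') (at z)"
    and "0 < e"
  shows "\<forall>\<^sub>F t in at_right 0.
    \<bar>(F (z + t *\<^sub>R u + t *\<^sub>R v) - F (z + t *\<^sub>R u) - F (z + t *\<^sub>R v) + F z)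
       - t\<^sup>2 * blinfun_apply (F'' u) v\<bar> \<le> e * t\<^sup>2 * (2 * norm v + norm u) * norm v"
proof -
  obtain d where "0 < d" and d: "\<And>y. norm (y - z) < d \<Longrightarrow>
      norm (F' y - F' z - F'' (y - z)) \<le> e * norm (y - z)"
    using F' \<open>0 < e\<close> unfolding has_derivative_at_alt by blast
  have lin: "linear F''"
    using F' by (rule has_derivative_linear)
  have *: "\<bar>(F (z + t *\<^sub>R u + t *\<^sub>R v) - F (z + t *\<^sub>R u) - F (z + t *\<^sub>R v) + F z)
       - t\<^sup>2 * blinfun_apply (F'' u) v\<bar> \<le> e * t\<^sup>2 * (2 * norm v + norm u) * norm v"
    if t: "0 < t" "t < d / (norm u + norm v + 1)" for t
  proof -
    have small: "t * (norm u + norm v) < d"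
    proof -
      have "t * (norm u + norm v + 1) < d"
        using t(2) by (simp add: pos_less_divide_eq add_nonneg_pos)
      then show ?thesis using t(1) by (simp add: distrib_left)
    qed
    \<comment> \<open>the second difference is \<open>\<phi> 1 - \<phi> 0\<close>\<close>
    define \<phi> where "\<phi> s = F (z + t *\<^sub>R u + s *\<^sub>R (t *\<^sub>R v)) - F (z + s *\<^sub>R (t *\<^sub>R v))" for s
    define \<phi>' where "\<phi>' s = blinfun_apply (F' (z + t *\<^sub>R u + s *\<^sub>R (t *\<^sub>R v))) (t *\<^sub>R v)
        - blinfun_apply (F' (z + s *\<^sub>R (t *\<^sub>R v))) (t *\<^sub>R v)" for s
    have line: "((\<lambda>s. F (y + s *\<^sub>R w)) has_derivative
        (\<lambda>k. blinfun_apply (F' (y + s *\<^sub>R w)) (k *\<^sub>R w))) (at s)" for y w s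
      by (rule has_derivative_compose[OF _ F]) (auto intro!: derivative_eq_intros)
    have "(\<phi> has_real_derivative \<phi>' s) (at s)" for s
      unfolding \<phi>_def has_field_derivative_def
      by (rule has_derivative_eq_rhs[OF has_derivative_diff[OF line line]])
        (simp add: fun_eq_iff \<phi>'_def blinfun.scaleR_right algebra_simps)
    then obtain s where s: "0 < s" "s < 1" and mvt: "\<phi> 1 - \<phi> 0 = \<phi>' s"
      using MVT2[of 0 1 \<phi> \<phi>'] by auto
    define p q where "p = t *\<^sub>R u + s *\<^sub>R (t *\<^sub>R v)" and "q = s *\<^sub>R (t *\<^sub>R v)"
    have nq: "norm q \<le> t * norm v"
      using s t by (simp add: q_def mult_left_le_one_le)
    have np: "norm p \<le> t * norm u + t * norm v"
      using norm_triangle_ineq[of "t *\<^sub>R u" q] nq t by (simp add: p_def q_def)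
    have "t * norm u \<ge> 0" using t by simp
    then have pd: "norm p < d" and qd: "norm q < d"
      using small np nq by (auto simp: distrib_left)
    define rp rq where "rp = F' (z + p) - F' z - F'' p" and "rq = F' (z + q) - F' z - F'' q"
    have rp: "norm rp \<le> e * norm p" and rq: "norm rq \<le> e * norm q"
      using d[of "z + p"] d[of "z + q"] pd qd by (auto simp: rp_def rq_def)
    have "F'' p - F'' q = t *\<^sub>R F'' u"
      unfolding p_def q_def using linear_add[OF lin] linear_cmul[OF lin] by simp
    then have "F' (z + p) - F' (z + q) = t *\<^sub>R F'' u + (rp - rq)"
      by (simp add: rp_def rq_def algebra_simps)
    moreover have "\<phi>' s = blinfun_apply (F' (z + p) - F' (z + q)) (t *\<^sub>R v)"
      by (simp add: \<phi>'_def p_def q_def blinfun.diff_left add.assoc)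
    ultimately have "\<phi>' s - t\<^sup>2 * blinfun_apply (F'' u) v = blinfun_apply (rp - rq) (t *\<^sub>R v)"
      by (simp add: blinfun.add_left blinfun.scaleR_left blinfun.scaleR_right power2_eq_square distrib_left)
    also have "\<bar>\<dots>\<bar> \<le> norm (rp - rq) * norm (t *\<^sub>R v)"
      using norm_blinfun[of "rp - rq" "t *\<^sub>R v"] by simp
    also have "\<dots> \<le> (e * (t * (2 * norm v + norm u))) * norm (t *\<^sub>R v)"
    proof (rule mult_right_mono)
      have "norm (rp - rq) \<le> e * (norm p + norm q)"
        using norm_triangle_ineq4[of rp rq] rp rq by (simp add: distrib_left)
      also have "\<dots> \<le> e * (t * (2 * norm v + norm u))"
        using np nq \<open>0 < e\<close> by (intro mult_left_mono) (auto simp: algebra_simps)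
      finally show "norm (rp - rq) \<le> e * (t * (2 * norm v + norm u))" .
    qed simp
    also have "\<dots> = e * t\<^sup>2 * (2 * norm v + norm u) * norm v"
      using t by (simp add: power2_eq_square)
    finally show ?thesis
      using mvt by (simp add: \<phi>_def algebra_simps)
  qed
  have "0 < d / (norm u + norm v + 1)"
    using \<open>0 < d\<close> by (simp add: add_nonneg_pos)
  then show ?thesis
    unfolding eventually_at_right_field using * by blast
qed

text \<open>
  The second difference is symmetric in \<open>u\<close> and \<open>v\<close>, and divided by \<open>t\<^sup>2\<close> it approximates both sides.
\<close>
lemma second_derivative_symmetric:
  fixes F :: "'a::real_normed_vector \<Rightarrow> real" and F' :: "'a \<Rightarrow> 'a \<Rightarrow>\<^sub>L real"
  assumes F: "\<And>y. (F has_derivative F' y) (at y)"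
    and F': "(F' has_derivative F'') (at z)"
  shows "blinfun_apply (F'' u) v = blinfun_apply (F'' v) u"
proof -
  define K where "K = (2 * norm v + norm u) * norm v + (2 * norm u + norm v) * norm u"
  have "\<bar>blinfun_apply (F'' u) v - blinfun_apply (F'' v) u\<bar> \<le> e * K" if "0 < e" for e
  proof -
    let ?D = "\<lambda>t u v. F (z + t *\<^sub>R u + t *\<^sub>R v) - F (z + t *\<^sub>R u) - F (z + t *\<^sub>R v) + F z"
    have "\<forall>\<^sub>F t in at_right (0::real). 0 < t"
      by (simp add: eventually_at_filter)
    with second_difference_estimate[OF assms that, of u v]
      second_difference_estimate[OF assms that, of v u]
    have "\<forall>\<^sub>F t in at_right 0. 0 < t \<and>
        \<bar>?D t u v - t\<^sup>2 * blinfun_apply (F'' u) v\<bar> \<le> e * t\<^sup>2 * (2 * norm v + norm u) * norm v \<and>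
        \<bar>?D t v u - t\<^sup>2 * blinfun_apply (F'' v) u\<bar> \<le> e * t\<^sup>2 * (2 * norm u + norm v) * norm u"
      by eventually_elim (intro conjI)
    from eventually_happens'[OF trivial_limit_at_right_real this]
    obtain t :: real where "0 < t"
      and uv: "\<bar>?D t u v - t\<^sup>2 * blinfun_apply (F'' u) v\<bar> \<le> e * t\<^sup>2 * (2 * norm v + norm u) * norm v"
      and vu: "\<bar>?D t v u - t\<^sup>2 * blinfun_apply (F'' v) u\<bar> \<le> e * t\<^sup>2 * (2 * norm u + norm v) * norm u"
      by (elim exE conjE) rule
    have "?D t u v = ?D t v u"
      by (simp add: algebra_simps)
    then have "\<bar>t\<^sup>2 * blinfun_apply (F'' u) v - t\<^sup>2 * blinfun_apply (F'' v) u\<bar>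
        \<le> e * t\<^sup>2 * (2 * norm v + norm u) * norm v + e * t\<^sup>2 * (2 * norm u + norm v) * norm u"
      using uv vu by linarith
    also have "\<dots> = t\<^sup>2 * (e * K)"
      by (simp add: K_def algebra_simps)
    also have "\<bar>t\<^sup>2 * blinfun_apply (F'' u) v - t\<^sup>2 * blinfun_apply (F'' v) u\<bar>
        = t\<^sup>2 * \<bar>blinfun_apply (F'' u) v - blinfun_apply (F'' v) u\<bar>"
      by (simp add: right_diff_distrib[symmetric] abs_mult)
    finally show ?thesis
      using \<open>0 < t\<close> by simp
  qed
  note bound = this
  have "K \<ge> 0" by (simp add: K_def)
  have "\<bar>blinfun_apply (F'' u) v - blinfun_apply (F'' v) u\<bar> \<le> 0"
  proof (rule field_le_epsilon)
    fix e :: real assume "0 < e"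
    then have "e / (K + 1) * K \<le> e"
      using \<open>K \<ge> 0\<close> by (simp add: field_simps)
    then show "\<bar>blinfun_apply (F'' u) v - blinfun_apply (F'' v) u\<bar> \<le> 0 + e"
      using bound[of "e / (K + 1)"] \<open>0 < e\<close> \<open>K \<ge> 0\<close> by simp
  qed
  then show ?thesis by simp
qed

text \<open>
  Passing from derivatives, which are functionals, to the vectors that represent them commutes
  with differentiation. The map \<open>L\<close> selects a factor of a product space, so the lemma covers both
  partial gradients.
\<close>
lemma has_derivative_riesz:
  fixes v :: "'a::real_normed_vector \<Rightarrow> 'b::euclidean_space"
    and F' :: "'a \<Rightarrow> 'a \<Rightarrow>\<^sub>L real"
  assumes v: "\<And>z w. inner w (v z) = blinfun_apply (F' z) (L w)"
    and F': "(F' has_derivative F'') (at z)"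
    and L: "linear L"
  obtains Q where "(v has_derivative Q) (at z)"
    "\<And>k w. inner w (Q k) = blinfun_apply (F'' k) (L w)"
proof
  let ?Q = "\<lambda>k. \<Sum>b\<in>Basis. blinfun_apply (F'' k) (L b) *\<^sub>R b"
  have "v = (\<lambda>z. \<Sum>b\<in>Basis. blinfun_apply (F' z) (L b) *\<^sub>R b)"
    by (simp add: v[symmetric] inner_commute[of _ "v _"] euclidean_representation)
  moreover have "((\<lambda>z. \<Sum>b\<in>Basis. blinfun_apply (F' z) (L b) *\<^sub>R b) has_derivative ?Q) (at z)"
    by (intro has_derivative_sum has_derivative_scaleR_left
        bounded_linear.has_derivative[OF blinfun.bounded_linear_left F'])
  ultimately show "(v has_derivative ?Q) (at z)" by simp
  have L_rep: "L w = (\<Sum>b\<in>Basis. (w \<bullet> b) *\<^sub>R L b)" for w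
    using linear_sum[OF L, of "\<lambda>b. (w \<bullet> b) *\<^sub>R b" Basis] linear_cmul[OF L]
    by (simp add: euclidean_representation)
  show "inner w (?Q k) = blinfun_apply (F'' k) (L w)" for k w
    by (subst (2) L_rep) (simp add: inner_sum_right blinfun.sum_right blinfun.scaleR_right mult.commute)
qed

text \<open>
  Both matrices are defined as \<open>\<theta>\<close>-derivatives of a partial gradient. Symmetry of the second
  derivative is what makes the transposed mixed Jacobian the \<open>x\<close>-derivative of \<open>grad_\<theta>\<close>; the
  product \<open>h v* A\<close> is that transpose applied to \<open>h\<close>.
\<close>
lemma second_order_structure:
  fixes g :: "real^'n \<Rightarrow> real^'p \<Rightarrow> real"
  assumes "twice_cont_diff (\<lambda>(x, \<theta>). g x \<theta>)"
  shows has_derivative_grad_\<theta>: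
    "((\<lambda>z. grad_\<theta> g (fst z) (snd z)) has_derivative
        (\<lambda>k. fst k v* jac_x\<theta> g x \<theta> + hess_\<theta>\<theta> g x \<theta> *v snd k)) (at (x, \<theta>))"
    and hess_\<theta>\<theta>_symmetric: "inner v (hess_\<theta>\<theta> g x \<theta> *v w) = inner (hess_\<theta>\<theta> g x \<theta> *v v) w"
proof -
  obtain G' :: "(real^'n) \<times> (real^'p) \<Rightarrow> ((real^'n) \<times> (real^'p)) \<Rightarrow>\<^sub>L real"
    where G': "\<And>z. ((\<lambda>(x, \<theta>). g x \<theta>) has_derivative blinfun_apply (G' z)) (at z)" and "cont_diff G'"
    using assms unfolding twice_cont_diff_def by blast
  then obtain G'' where G'': "(G' has_derivative G'') (at (x, \<theta>))"
    unfolding cont_diff_def by blast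
  note sym = second_derivative_symmetric[OF G' G'']
  have "linear (\<lambda>h::real^'n. (h, 0::real^'p))" "linear (\<lambda>k::real^'p. (0::real^'n, k))"
    by (auto intro!: linearI)
  note lin = this
  obtain P where P: "((\<lambda>z. grad_x g (fst z) (snd z)) has_derivative P) (at (x, \<theta>))"
    and P_inner: "\<And>k h. inner h (P k) = blinfun_apply (G'' k) (h, 0)"
    by (rule has_derivative_riesz[OF _ G'' lin(1), of "\<lambda>z. grad_x g (fst z) (snd z)"])
      (auto intro!: inner_grad_x[THEN trans] G' simp del: split_paired_All)
  obtain Q where Q: "((\<lambda>z. grad_\<theta> g (fst z) (snd z)) has_derivative Q) (at (x, \<theta>))"
    and Q_inner: "\<And>k w. inner w (Q k) = blinfun_apply (G'' k) (0, w)"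
    by (rule has_derivative_riesz[OF _ G'' lin(2), of "\<lambda>z. grad_\<theta> g (fst z) (snd z)"])
      (auto intro!: inner_grad_\<theta>[THEN trans] G' simp del: split_paired_All)
  have J: "jac_x\<theta> g x \<theta> *v k = P (0, k)" for k
    unfolding jac_x\<theta>_def
    by (rule jacobian_mult_vec[OF has_derivative_right_section[of "\<lambda>x \<theta>. grad_x g x \<theta>"]])
      (use P in \<open>unfold case_prod_unfold\<close>)
  have H: "hess_\<theta>\<theta> g x \<theta> *v k = Q (0, k)" for k
    unfolding hess_\<theta>\<theta>_def
    by (rule jacobian_mult_vec[OF has_derivative_right_section[of "\<lambda>x \<theta>. grad_\<theta> g x \<theta>"]])
      (use Q in \<open>unfold case_prod_unfold\<close>)
  show "inner v (hess_\<theta>\<theta> g x \<theta> *v w) = inner (hess_\<theta>\<theta> g x \<theta> *v v) w" for v w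
    using sym[of "(0, v)" "(0, w)"] by (simp add: H Q_inner inner_commute[of _ w])
  have "inner w (Q (h, 0)) = inner w (h v* jac_x\<theta> g x \<theta>)" for w h
    using sym[of "(0, w)" "(h, 0)"]
    by (simp add: Q_inner inner_commute[of w] dot_lmul_matrix J P_inner)
  then have "Q (h, 0) = h v* jac_x\<theta> g x \<theta>" for h
    by (metis vector_eq_ldot)
  then have "Q k = fst k v* jac_x\<theta> g x \<theta> + hess_\<theta>\<theta> g x \<theta> *v snd k" for k
    using linear_add[OF has_derivative_linear[OF Q], of "(fst k, 0)" "(0, snd k)"] by (simp add: H)
  then show "((\<lambda>z. grad_\<theta> g (fst z) (snd z)) has_derivative
        (\<lambda>k. fst k v* jac_x\<theta> g x \<theta> + hess_\<theta>\<theta> g x \<theta> *v snd k)) (at (x, \<theta>))"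
    using Q by presburger
qed

section \<open>Strongly convex functions\<close>

lemma difference_quotient_tendsto_at_right:
  assumes "(\<phi> has_real_derivative a) (at 0)"
  shows "((\<lambda>t. (\<phi> t - \<phi> 0) / t) \<longlongrightarrow> a) (at_right 0)"
  using has_field_derivative_at_within[OF assms, of "{0<..}"]
  unfolding has_field_derivative_iff by simp

text \<open>
  Compare the defining inequality on the segment from \<open>v\<close> to \<open>u\<close> with the slope of \<open>F\<close> at \<open>v\<close>: divide
  by the parameter \<open>t\<close> and let it decrease to 0.
\<close>
lemma strongly_convex_gradient_inequality:
  assumes sc: "strongly_convex \<mu> F" and d: "GDERIV F v :> d"
  shows "F v + inner (u - v) d + \<mu> / 2 * (norm (u - v))\<^sup>2 \<le> F u"
proof -
  have line: "((\<lambda>t. F (v + t *\<^sub>R (u - v))) has_derivative (\<lambda>k. inner (k *\<^sub>R (u - v)) d)) (at 0)"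
    by (rule has_derivative_compose[of "\<lambda>t. v + t *\<^sub>R (u - v)" "\<lambda>k. k *\<^sub>R (u - v)" 0 UNIV F "\<lambda>h. inner h d"])
      (use d in \<open>auto intro!: derivative_eq_intros simp: gderiv_def\<close>)
  have "((\<lambda>t. F (v + t *\<^sub>R (u - v))) has_real_derivative inner (u - v) d) (at 0)"
    unfolding has_field_derivative_def by (rule has_derivative_eq_rhs[OF line]) auto
  then have lim: "((\<lambda>t. (F (v + t *\<^sub>R (u - v)) - F v) / t) \<longlongrightarrow> inner (u - v) d) (at_right 0)"
    by (auto dest!: difference_quotient_tendsto_at_right)
  have "((\<lambda>t. F u - F v - \<mu> / 2 * (1 - t) * (norm (u - v))\<^sup>2) \<longlongrightarrow>
      F u - F v - \<mu> / 2 * (1 - 0) * (norm (u - v))\<^sup>2) (at_right 0)"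
    by (intro tendsto_intros)
  moreover have "(F (v + t *\<^sub>R (u - v)) - F v) / t \<le> F u - F v - \<mu> / 2 * (1 - t) * (norm (u - v))\<^sup>2"
    if "0 < t" "t < 1" for t
  proof -
    have "F (t *\<^sub>R u + (1 - t) *\<^sub>R v)
        \<le> t * F u + (1 - t) * F v - \<mu> / 2 * t * (1 - t) * (norm (u - v))\<^sup>2"
      using sc that unfolding strongly_convex_def by auto
    moreover have "t *\<^sub>R u + (1 - t) *\<^sub>R v = v + t *\<^sub>R (u - v)"
      by (simp add: algebra_simps)
    ultimately have "F (v + t *\<^sub>R (u - v)) - F v
        \<le> (F u - F v - \<mu> / 2 * (1 - t) * (norm (u - v))\<^sup>2) * t"
      by (simp add: algebra_simps)
    then show ?thesis
      using that by (simp add: pos_divide_le_eq)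
  qed
  then have "\<forall>\<^sub>F t in at_right 0. (F (v + t *\<^sub>R (u - v)) - F v) / t
      \<le> F u - F v - \<mu> / 2 * (1 - t) * (norm (u - v))\<^sup>2"
    unfolding eventually_at_right_field by (intro exI[of _ 1]) auto
  ultimately have "inner (u - v) d \<le> F u - F v - \<mu> / 2 * (1 - 0) * (norm (u - v))\<^sup>2"
    using tendsto_le[OF trivial_limit_at_right_real _ lim] by blast
  then show ?thesis by simp
qed

lemma strongly_convex_gradient_monotone:
  assumes "strongly_convex \<mu> F" "GDERIV F u :> d" "GDERIV F v :> e"
  shows "\<mu> * (norm (u - v))\<^sup>2 \<le> inner (u - v) (d - e)"
  using strongly_convex_gradient_inequality[OF assms(1,2), of v]
    strongly_convex_gradient_inequality[OF assms(1,3), of u]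
  by (simp add: norm_minus_commute[of v u] inner_diff_left inner_diff_right)

text \<open>
  The quadratic lower bound at 0 beats the linear term outside a ball, so a minimum over
  that compact ball is global.
\<close>
lemma strongly_convex_attains_min:
  fixes F :: "'a::euclidean_space \<Rightarrow> real"
  assumes sc: "strongly_convex \<mu> F" and "0 < \<mu>" and F: "\<And>v. GDERIV F v :> dF v"
  shows "\<exists>z. \<forall>v. F z \<le> F v"
proof -
  \<comment> \<open>the radius beyond which \<open>\<mu> / 2 * |v|\<^sup>2\<close> dominates \<open>|v| * |dF 0|\<close>\<close>
  define r where "r = 2 * norm (dF 0) / \<mu>"
  have "0 \<le> r" using \<open>0 < \<mu>\<close> by (simp add: r_def)
  have "continuous_on (cball 0 r) F"
    by (meson F continuous_at_imp_continuous_on gderiv_def has_derivative_continuous)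
  moreover have "cball 0 r \<noteq> ({} :: 'a set)"
    using \<open>0 \<le> r\<close> by simp
  ultimately obtain z where z: "\<And>v. v \<in> cball 0 r \<Longrightarrow> F z \<le> F v"
    using continuous_attains_inf compact_cball by metis
  have "F z \<le> F v" if "v \<notin> cball 0 r" for v
  proof -
    have "norm (dF 0) \<le> \<mu> / 2 * norm v"
      using that \<open>0 < \<mu>\<close> by (simp add: r_def field_simps)
    then have "norm v * norm (dF 0) \<le> norm v * (\<mu> / 2 * norm v)"
      by (rule mult_left_mono) simp
    moreover have "- (norm v * norm (dF 0)) \<le> inner v (dF 0)"
      using Cauchy_Schwarz_ineq2[of v "dF 0"] by linarith
    ultimately have "F 0 \<le> F v"
      using strongly_convex_gradient_inequality[OF sc F, of 0 v] by (simp add: power2_eq_square mult_ac)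
    moreover have "F z \<le> F 0"
      using z \<open>0 \<le> r\<close> by simp
    ultimately show ?thesis by simp
  qed
  then show ?thesis
    using z by blast
qed

text \<open>
  Strong monotonicity along \<open>v + t w\<close>, divided by \<open>t\<^sup>2\<close>, passes to the limit \<open>t \<rightarrow> 0\<close>.
\<close>
lemma strongly_monotone_imp_coercive_derivative:
  fixes G :: "'a::real_inner \<Rightarrow> 'a"
  assumes mono: "\<And>u. \<mu> * (norm (u - v))\<^sup>2 \<le> inner (u - v) (G u - G v)"
    and G: "(G has_derivative D) (at v)"
  shows "\<mu> * (norm w)\<^sup>2 \<le> inner w (D w)"
proof -
  have "((\<lambda>t. inner w (G (v + t *\<^sub>R w))) has_derivative (\<lambda>k. inner w (D (k *\<^sub>R w)))) (at 0)"
    by (intro has_derivative_inner_right has_derivative_compose[of "\<lambda>t. v + t *\<^sub>R w" "\<lambda>k. k *\<^sub>R w" 0 UNIV G D])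
      (use G in \<open>auto intro!: derivative_eq_intros\<close>)
  then have "((\<lambda>t. inner w (G (v + t *\<^sub>R w))) has_real_derivative inner w (D w)) (at 0)"
    unfolding has_field_derivative_def
    by (rule has_derivative_eq_rhs) (simp add: fun_eq_iff linear_cmul[OF has_derivative_linear[OF G]])
  then have lim: "((\<lambda>t. (inner w (G (v + t *\<^sub>R w)) - inner w (G v)) / t) \<longlongrightarrow> inner w (D w)) (at_right 0)"
    by (auto dest!: difference_quotient_tendsto_at_right)
  have "\<mu> * (norm w)\<^sup>2 \<le> (inner w (G (v + t *\<^sub>R w)) - inner w (G v)) / t" if "0 < t" for t
  proof -
    have "t * (\<mu> * (norm w)\<^sup>2 * t) = \<mu> * (norm (v + t *\<^sub>R w - v))\<^sup>2"
      by (simp add: power_mult_distrib power2_eq_square)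
    also have "\<dots> \<le> inner (v + t *\<^sub>R w - v) (G (v + t *\<^sub>R w) - G v)"
      by (rule mono)
    also have "\<dots> = t * (inner w (G (v + t *\<^sub>R w)) - inner w (G v))"
      by (simp add: inner_diff_right right_diff_distrib)
    finally have "t * (\<mu> * (norm w)\<^sup>2 * t) \<le> t * (inner w (G (v + t *\<^sub>R w)) - inner w (G v))" .
    then have "\<mu> * (norm w)\<^sup>2 * t \<le> inner w (G (v + t *\<^sub>R w)) - inner w (G v)"
      using that by (rule mult_left_le_imp_le)
    then show ?thesis
      using that by (simp only: pos_le_divide_eq)
  qed
  then have "\<forall>\<^sub>F t in at_right 0. \<mu> * (norm w)\<^sup>2 \<le> (inner w (G (v + t *\<^sub>R w)) - inner w (G v)) / t"
    unfolding eventually_at_right_field by (intro exI[of _ 1]) auto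
  then show ?thesis
    by (rule tendsto_lowerbound[OF lim _ trivial_limit_at_right_real])
qed

section \<open>Coercive matrices\<close>

lemma norm_coercive_le:
  fixes w z :: "'a::real_inner"
  assumes "\<mu> * (norm w)\<^sup>2 \<le> inner w z"
  shows "\<mu> * norm w \<le> norm z"
proof (cases "w = 0")
  case False
  have "norm w * (\<mu> * norm w) \<le> norm w * norm z"
    using assms norm_cauchy_schwarz[of w z] by (simp add: power2_eq_square mult_ac)
  then show ?thesis using False by simp
qed simp

lemma coercive_matrix_inv:
  fixes H :: "real^'p^'p"
  assumes "0 < \<mu>" and co: "\<And>w. \<mu> * (norm w)\<^sup>2 \<le> inner w (H *v w)"
  shows "H *v (matrix_inv H *v q) = q" and "matrix_inv H *v (H *v q) = q"
    and "norm (matrix_inv H *v q) \<le> norm q / \<mu>"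
proof -
  have "\<And>w. H *v w = 0 \<Longrightarrow> w = 0"
    using norm_coercive_le[OF co] \<open>0 < \<mu>\<close> by (metis mult_le_0_iff norm_le_zero_iff norm_zero not_le)
  then have "invertible H"
    using invertible_left_inverse matrix_left_invertible_ker by blast
  then have inv: "H ** matrix_inv H = mat 1 \<and> matrix_inv H ** H = mat 1"
    unfolding invertible_def matrix_inv_def by (rule someI_ex)
  then show right: "H *v (matrix_inv H *v q) = q" and "matrix_inv H *v (H *v q) = q"
    by (auto simp: matrix_vector_mul_assoc)
  show "norm (matrix_inv H *v q) \<le> norm q / \<mu>"
    using norm_coercive_le[OF co, of "matrix_inv H *v q"] \<open>0 < \<mu>\<close>
    by (simp add: right pos_le_divide_eq mult.commute)
qed

lemma norm_mult_vec_le_spectral_norm: "norm (A *v v) \<le> spectral_norm A * norm v"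
  unfolding spectral_norm_def by (rule onorm) simp

lemma spectral_norm_nonneg: "0 \<le> spectral_norm A"
  unfolding spectral_norm_def by (rule onorm_pos_le) simp

section \<open>Implicit differentiation\<close>

text \<open>
  Implicit differentiation when a solution map \<open>s\<close> is already known. The expansion property of
  \<open>G\<close> in its second argument makes \<open>s\<close> Lipschitz at \<open>x\<close>, so the error of the linearisation of \<open>G\<close> along the graph
  of \<open>s\<close> is small compared with \<open>y - x\<close>; applying the left inverse \<open>R\<close> of the partial
  derivative \<open>B\<close> isolates the increment of \<open>s\<close>.
\<close>
lemma implicit_solution_has_derivative:
  fixes G :: "'a::real_normed_vector \<times> 'b::real_normed_vector \<Rightarrow> 'c::real_normed_vector"
  assumes G: "(G has_derivative (\<lambda>k. A (fst k) + B (snd k))) (at (x, s x))"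
    and zero: "\<And>y. G (y, s y) = 0"
    and "0 < \<mu>" and expand: "\<And>y u v. \<mu> * norm (u - v) \<le> norm (G (y, u) - G (y, v))"
    and A: "bounded_linear A" and R: "bounded_linear R" and RB: "\<And>k. R (B k) = k"
  shows "(s has_derivative (\<lambda>h. - R (A h))) (at x)"
  unfolding has_derivative_at_alt
proof (intro conjI allI impI)
  show "bounded_linear (\<lambda>h. - R (A h))"
    by (intro bounded_linear_minus bounded_linear_compose[OF R A])
  fix e :: real assume "0 < e"
  \<comment> \<open>a Lipschitz constant of \<open>s\<close> at \<open>x\<close>; the summand 1 is the error of the linearisation\<close>
  define K where "K = (onorm A + 1) / \<mu>"
  have "0 \<le> onorm A" using A by (rule onorm_pos_le)
  then have "0 < K" using \<open>0 < \<mu>\<close> by (simp add: K_def)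
  \<comment> \<open>\<open>R\<close> and the passage from graph increments to \<open>y - x\<close> (factor \<open>1 + K\<close>) magnify the error\<close>
  define \<epsilon> where "\<epsilon> = e / ((onorm R + 1) * (1 + K))"
  have "0 \<le> onorm R" using R by (rule onorm_pos_le)
  then have "0 < \<epsilon>" using \<open>0 < e\<close> \<open>0 < K\<close> by (simp add: \<epsilon>_def)
  have "linear (\<lambda>k. A (fst k) + B (snd k))"
    using G by (rule has_derivative_linear)
  from linear_0[OF this] have AB0: "A 0 + B 0 = 0" by simp
  have "A 0 = 0" using A by (rule linear_simps)
  then have "B 0 = 0" using AB0 by simp
  obtain d1 where "0 < d1" and d1: "\<And>z. norm (z - (x, s x)) < d1 \<Longrightarrow>
      norm (G z - G (x, s x) - (A (fst (z - (x, s x))) + B (snd (z - (x, s x)))))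
        \<le> 1 * norm (z - (x, s x))"
    using G unfolding has_derivative_at_alt by (meson zero_less_one)
  obtain d2 where "0 < d2" and d2: "\<And>z. norm (z - (x, s x)) < d2 \<Longrightarrow>
      norm (G z - G (x, s x) - (A (fst (z - (x, s x))) + B (snd (z - (x, s x)))))
        \<le> \<epsilon> * norm (z - (x, s x))"
    using G \<open>0 < \<epsilon>\<close> unfolding has_derivative_at_alt by meson
  have "norm (s y - s x - - R (A (y - x))) \<le> e * norm (y - x)"
    if y: "norm (y - x) < min d1 (d2 / (1 + K))" for y
  proof -
    have "norm (G (y, s x) - A (y - x)) \<le> norm (y - x)"
      using d1[of "(y, s x)"] y by (simp add: zero \<open>B 0 = 0\<close> norm_Pair)
    then have "norm (G (y, s x)) \<le> (onorm A + 1) * norm (y - x)"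
      using onorm[OF A, of "y - x"] norm_triangle_sub[of "G (y, s x)" "A (y - x)"]
      by (simp add: distrib_right)
    moreover have "\<mu> * norm (s y - s x) \<le> norm (G (y, s x))"
      using expand[of "s y" "s x" y] by (simp add: zero)
    ultimately have lip: "norm (s y - s x) \<le> K * norm (y - x)"
      using \<open>0 < \<mu>\<close> unfolding K_def by (simp add: field_simps)
    let ?z = "(y, s y) - (x, s x)"
    have nz: "norm ?z \<le> (1 + K) * norm (y - x)"
      using norm_Pair_le[of "y - x" "s y - s x"] lip by (simp add: distrib_right)
    also have "\<dots> < d2"
      using y \<open>0 < K\<close> by (simp add: pos_less_divide_eq mult.commute)
    finally have "norm (A (y - x) + B (s y - s x)) \<le> \<epsilon> * norm ?z"
      using d2[of "(y, s y)"] norm_minus_cancel[of "A (y - x) + B (s y - s x)"]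
      by (simp add: zero)
    also have "\<dots> \<le> \<epsilon> * ((1 + K) * norm (y - x))"
      using nz \<open>0 < \<epsilon>\<close> by simp
    finally have err: "norm (A (y - x) + B (s y - s x)) \<le> \<epsilon> * ((1 + K) * norm (y - x))" .
    have "s y - s x - - R (A (y - x)) = R (A (y - x) + B (s y - s x))"
      using linear_add[OF bounded_linear.linear[OF R]] by (simp add: RB)
    then have "norm (s y - s x - - R (A (y - x))) \<le> onorm R * norm (A (y - x) + B (s y - s x))"
      using onorm[OF R] by simp
    also have "\<dots> \<le> (onorm R + 1) * (\<epsilon> * ((1 + K) * norm (y - x)))"
      using err \<open>0 \<le> onorm R\<close> by (intro mult_mono) auto
    also have "\<dots> = e * norm (y - x)"
      using \<open>0 \<le> onorm R\<close> \<open>0 < K\<close> by (simp add: \<epsilon>_def)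
    finally show ?thesis .
  qed
  moreover have "0 < min d1 (d2 / (1 + K))"
    using \<open>0 < d1\<close> \<open>0 < d2\<close> \<open>0 < K\<close> by simp
  ultimately show "\<exists>d>0. \<forall>y. norm (y - x) < d \<longrightarrow>
      norm (s y - s x - - R (A (y - x))) \<le> e * norm (y - x)"
    by blast
qed

section \<open>The inner problem and the hypergradient\<close>

lemma twice_cont_diff_imp_has_derivative:
  assumes "twice_cont_diff F"
  shows "\<exists>D. (F has_derivative D) (at z)"
  using assms unfolding twice_cont_diff_def by blast

lemma twice_cont_diff_GDERIV_\<theta>:
  assumes "twice_cont_diff (\<lambda>(x, \<theta>). g x \<theta>)"
  shows "GDERIV (g x) \<theta> :> grad_\<theta> g x \<theta>"
proof -
  obtain D where "((\<lambda>(x, \<theta>). g x \<theta>) has_derivative D) (at (x, \<theta>))"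
    using twice_cont_diff_imp_has_derivative[OF assms] by blast
  from GDERIV_grad[OF has_derivative_right_section[OF this]]
  show ?thesis by (simp add: grad_\<theta>_def)
qed

text \<open>
  The setting in which the inner minimiser exists, is unique and depends differentiably on \<open>x\<close>.
\<close>
locale strongly_convex_inner =
  fixes \<mu> :: real and g :: "real^'n \<Rightarrow> real^'p \<Rightarrow> real"
  assumes \<mu>_pos: "0 < \<mu>"
    and sc: "\<And>x. strongly_convex \<mu> (g x)"
    and smooth: "twice_cont_diff (\<lambda>(x, \<theta>). g x \<theta>)"
begin

lemma GDERIV_g: "GDERIV (g x) \<theta> :> grad_\<theta> g x \<theta>"
  by (rule twice_cont_diff_GDERIV_\<theta>[OF smooth])

lemma inner_sol_le: "g x (inner_sol g x) \<le> g x \<theta>"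
proof -
  obtain z where "\<And>v. g x z \<le> g x v"
    using strongly_convex_attains_min[OF sc \<mu>_pos GDERIV_g] by blast
  then have "\<forall>v. g x (inner_sol g x) \<le> g x v"
    unfolding inner_sol_def
    by (intro arg_minI[of "\<lambda>_. True" z "g x" "\<lambda>w. \<forall>v. g x w \<le> g x v"]) (auto simp: not_less)
  then show ?thesis ..
qed

lemma grad_\<theta>_inner_sol: "grad_\<theta> g x (inner_sol g x) = 0"
proof -
  have "(\<lambda>h. inner h (grad_\<theta> g x (inner_sol g x))) = (\<lambda>h. 0)"
    using GDERIV_g inner_sol_le unfolding gderiv_def
    by (intro has_derivative_local_min[of "g x"]) auto
  then show ?thesis
    by (metis inner_eq_zero_iff)
qed

lemma grad_\<theta>_monotone:
  "\<mu> * (norm (u - v))\<^sup>2 \<le> inner (u - v) (grad_\<theta> g x u - grad_\<theta> g x v)"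
  by (rule strongly_convex_gradient_monotone[OF sc GDERIV_g GDERIV_g])

lemma norm_grad_\<theta>_diff_ge: "\<mu> * norm (u - v) \<le> norm (grad_\<theta> g x u - grad_\<theta> g x v)"
  by (rule norm_coercive_le[OF grad_\<theta>_monotone])

lemma hess_coercive: "\<mu> * (norm w)\<^sup>2 \<le> inner w (hess_\<theta>\<theta> g x \<theta> *v w)"
proof (rule strongly_monotone_imp_coercive_derivative[OF grad_\<theta>_monotone])
  have "((\<lambda>(x, \<theta>). grad_\<theta> g x \<theta>) has_derivative
      (\<lambda>k. fst k v* jac_x\<theta> g x \<theta> + hess_\<theta>\<theta> g x \<theta> *v snd k)) (at (x, \<theta>))"
    using has_derivative_grad_\<theta>[OF smooth] unfolding case_prod_unfold .
  from has_derivative_right_section[OF this]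
  show "(grad_\<theta> g x has_derivative (\<lambda>k. hess_\<theta>\<theta> g x \<theta> *v k)) (at \<theta>)"
    by simp
qed

lemmas hess_inv = coercive_matrix_inv[OF \<mu>_pos hess_coercive]

lemma inner_sol_has_derivative:
  "(inner_sol g has_derivative
      (\<lambda>h. - (matrix_inv (hess_\<theta>\<theta> g x (inner_sol g x)) *v (h v* jac_x\<theta> g x (inner_sol g x))))) (at x)"
proof (rule implicit_solution_has_derivative[where \<mu> = \<mu>
      and G = "\<lambda>z. grad_\<theta> g (fst z) (snd z)"
      and A = "\<lambda>h. h v* jac_x\<theta> g x (inner_sol g x)"
      and B = "\<lambda>k. hess_\<theta>\<theta> g x (inner_sol g x) *v k"
      and R = "\<lambda>q. matrix_inv (hess_\<theta>\<theta> g x (inner_sol g x)) *v q"])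
  show "((\<lambda>z. grad_\<theta> g (fst z) (snd z)) has_derivative
      (\<lambda>k. fst k v* jac_x\<theta> g x (inner_sol g x) + hess_\<theta>\<theta> g x (inner_sol g x) *v snd k))
      (at (x, inner_sol g x))"
    by (rule has_derivative_grad_\<theta>[OF smooth])
  show "bounded_linear (\<lambda>h. h v* jac_x\<theta> g x (inner_sol g x))"
    unfolding transpose_matrix_vector[symmetric] by (rule matrix_vector_mul_bounded_linear)
qed (use \<mu>_pos norm_grad_\<theta>_diff_ge grad_\<theta>_inner_sol hess_inv in auto)

text \<open>
  The gradient vanishes at the minimiser, so strong monotonicity bounds the distance to it. This is how
  heterogeneity of the inner gradients controls the distance between the minimisers of two nodes.
\<close>
lemma norm_inner_sol_diff_le: "norm (inner_sol g x - \<theta>) \<le> norm (grad_\<theta> g x \<theta>) / \<mu>"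
  using norm_grad_\<theta>_diff_ge[of "inner_sol g x" \<theta> x] \<mu>_pos
  by (simp add: grad_\<theta>_inner_sol pos_le_divide_eq mult.commute)

end

text \<open>
  The closed form that the chain rule gives for the gradient of \<open>local_obj\<close>.
\<close>
definition hypergradient ::
  "(real^'n \<Rightarrow> real^'p \<Rightarrow> real) \<Rightarrow> (real^'n \<Rightarrow> real^'p \<Rightarrow> real) \<Rightarrow> real^'n \<Rightarrow> real^'n" where
  "hypergradient f g x = grad_x f x (inner_sol g x)
     - jac_x\<theta> g x (inner_sol g x) *v
         (matrix_inv (hess_\<theta>\<theta> g x (inner_sol g x)) *v grad_\<theta> f x (inner_sol g x))"

text \<open>
  The chain rule leaves the inverse Hessian acting on the direction \<open>h\<close>; symmetry of the Hessian
  moves it to the gradient of \<open>f\<close>.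
\<close>
lemma (in strongly_convex_inner) GDERIV_local_obj:
  assumes "cont_diff (\<lambda>(x, \<theta>). f x \<theta>)"
  shows "GDERIV (local_obj f g) x :> hypergradient f g x"
proof -
  let ?\<theta> = "inner_sol g x"
  let ?J = "jac_x\<theta> g x ?\<theta>" and ?H = "hess_\<theta>\<theta> g x ?\<theta>"
  let ?R = "\<lambda>q. matrix_inv ?H *v q"
  obtain D where D: "((\<lambda>(x, \<theta>). f x \<theta>) has_derivative D) (at (x, ?\<theta>))"
    using assms unfolding cont_diff_def by blast
  have R_sym: "inner (?R p) q = inner p (?R q)" for p q
    using hess_\<theta>\<theta>_symmetric[OF smooth, of "?R p" x ?\<theta> "?R q"] by (simp add: hess_inv)
  have "((\<lambda>y. (y, inner_sol g y)) has_derivative (\<lambda>h. (h, - ?R (h v* ?J)))) (at x)"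
    by (intro has_derivative_Pair has_derivative_ident inner_sol_has_derivative)
  from has_derivative_compose[OF this D]
  have "(local_obj f g has_derivative (\<lambda>h. D (h, - ?R (h v* ?J)))) (at x)"
    by (simp add: local_obj_def[abs_def])
  moreover have "D (h, - ?R (h v* ?J)) = inner h (hypergradient f g x)" for h
    by (simp add: total_derivative_grads[OF D] hypergradient_def inner_diff_right R_sym dot_lmul_matrix)
  ultimately show ?thesis
    by (simp add: gderiv_def)
qed

lemma GDERIV_sum:
  assumes "\<And>i. i \<in> I \<Longrightarrow> GDERIV (F i) x :> D i"
  shows "GDERIV (\<lambda>y. \<Sum>i\<in>I. F i y) x :> (\<Sum>i\<in>I. D i)"
  using assms unfolding gderiv_def inner_sum_right by (rule has_derivative_sum)

lemma GDERIV_cmult: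
  fixes c :: real
  assumes "GDERIV F x :> D"
  shows "GDERIV (\<lambda>y. c * F y) x :> c *\<^sub>R D"
  using assms unfolding gderiv_def inner_scaleR_right by (rule has_derivative_mult_right)

lemma GDERIV_global_obj:
  assumes "\<And>i. i \<in> {1..m} \<Longrightarrow> GDERIV (local_obj (f i) (g i)) x :> v i"
  shows "GDERIV (global_obj m f g) x :> (1 / real m) *\<^sub>R (\<Sum>i=1..m. v i)"
  unfolding global_obj_def[abs_def] by (intro GDERIV_cmult GDERIV_sum assms)

section \<open>Sums of squared deviations\<close>

text \<open>
  The parallel axis identity: deviations from the mean sum to zero, so the cross terms cancel.
\<close>
lemma sum_sq_dist_decomp:
  fixes v :: "'i \<Rightarrow> 'a::real_inner"
  assumes "finite I" "I \<noteq> {}"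
  defines "c \<equiv> (1 / real (card I)) *\<^sub>R (\<Sum>i\<in>I. v i)"
  shows "(\<Sum>i\<in>I. (norm (v i - w))\<^sup>2) = (\<Sum>i\<in>I. (norm (v i - c))\<^sup>2) + real (card I) * (norm (c - w))\<^sup>2"
proof -
  have "real (card I) *\<^sub>R c = (\<Sum>i\<in>I. v i)"
    using assms by (simp add: c_def)
  then have "(\<Sum>i\<in>I. v i - c) = 0"
    by (simp add: sum_subtractf scaleR_conv_of_real sum_constant_scaleR)
  then have "(\<Sum>i\<in>I. inner (v i - c) (c - w)) = 0"
    by (simp add: inner_sum_left[symmetric])
  moreover have "(norm (v i - w))\<^sup>2
      = (norm (v i - c))\<^sup>2 + 2 * inner (v i - c) (c - w) + (norm (c - w))\<^sup>2" for i
    using dot_norm[of "v i - c" "c - w"] by (simp add: field_simps)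
  ultimately show ?thesis
    by (simp add: sum.distrib sum_distrib_left[symmetric])
qed

lemma sum_sq_dist_mean_le:
  fixes v :: "'i \<Rightarrow> 'a::real_inner"
  assumes "finite I" "I \<noteq> {}"
  shows "(\<Sum>i\<in>I. (norm (v i - (1 / real (card I)) *\<^sub>R (\<Sum>i\<in>I. v i)))\<^sup>2) \<le> (\<Sum>i\<in>I. (norm (v i - w))\<^sup>2)"
  using sum_sq_dist_decomp[OF assms, of v w] by simp

text \<open>
  Summing the parallel axis identity over the reference points \<open>w = v j\<close> counts the deviation
  from the mean twice. The resulting factor 2 is what the final constant relies on.
\<close>
lemma sum_sq_dist_pairs:
  fixes v :: "'i \<Rightarrow> 'a::real_inner"
  assumes "finite I" "I \<noteq> {}"
  defines "c \<equiv> (1 / real (card I)) *\<^sub>R (\<Sum>i\<in>I. v i)"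
  shows "(\<Sum>i\<in>I. \<Sum>j\<in>I. (norm (v i - v j))\<^sup>2) = 2 * real (card I) * (\<Sum>i\<in>I. (norm (v i - c))\<^sup>2)"
proof -
  have "(\<Sum>j\<in>I. (norm (v i - v j))\<^sup>2)
      = (\<Sum>j\<in>I. (norm (v j - c))\<^sup>2) + real (card I) * (norm (v i - c))\<^sup>2" for i
    using sum_sq_dist_decomp[OF assms(1,2), of v "v i"] unfolding c_def
    by (simp only: norm_minus_commute)
  then show ?thesis
    by (simp add: sum.distrib sum_distrib_left mult.assoc)
qed

lemma norm_sum2_sq_le:
  fixes a b :: "'a::real_normed_vector"
  shows "(norm (a + b))\<^sup>2 \<le> 2 * (norm a)\<^sup>2 + 2 * (norm b)\<^sup>2"
proof -
  have "(norm (a + b))\<^sup>2 \<le> (norm a + norm b)\<^sup>2"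
    by (intro power_mono norm_triangle_ineq) simp
  also have "\<dots> \<le> 2 * (norm a)\<^sup>2 + 2 * (norm b)\<^sup>2"
    using zero_le_power2[of "norm a - norm b"] by (simp add: power2_eq_square algebra_simps)
  finally show ?thesis .
qed

lemma norm_sum4_sq_le:
  fixes a b c d :: "'a::real_normed_vector"
  shows "(norm (a + b + c + d))\<^sup>2 \<le> 4 * ((norm a)\<^sup>2 + (norm b)\<^sup>2 + (norm c)\<^sup>2 + (norm d)\<^sup>2)"
  using norm_sum2_sq_le[of "a + b" "c + d"] norm_sum2_sq_le[of a b] norm_sum2_sq_le[of c d]
  by (simp add: add.assoc)

section \<open>The heterogeneity bound\<close>

text \<open>
  With \<open>p = H\<^sup>-\<^sup>1 q\<close>, the difference \<open>J H\<^sup>-\<^sup>1 q - K B\<^sup>-\<^sup>1 q\<close> equals \<open>(J - K) p + K B\<^sup>-\<^sup>1 (B - H) p\<close>, so the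
  perturbation of the inverse costs only one factor \<open>B\<^sup>-\<^sup>1\<close> beyond \<open>p\<close>. The intermediate matrices
  \<open>J'\<close>, \<open>H'\<close> split each difference into a change of the point, for one function, and a change of
  the function, at one point.
\<close>
lemma solve_map_difference_sq_le:
  fixes H H' B :: "real^'p^'p" and J J' K :: "real^'p^'n" and q :: "real^'p"
  assumes "0 < \<mu>"
    and H: "\<And>w. \<mu> * (norm w)\<^sup>2 \<le> inner w (H *v w)"
    and B: "\<And>w. \<mu> * (norm w)\<^sup>2 \<le> inner w (B *v w)"
    and K: "spectral_norm K \<le> C"
  defines "p \<equiv> matrix_inv H *v q"
  shows "(norm (J *v p - K *v (matrix_inv B *v q)))\<^sup>2
    \<le> 4 * (norm p)\<^sup>2 * ((spectral_norm (J - J'))\<^sup>2 + (spectral_norm (J' - K))\<^sup>2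
        + (C / \<mu>)\<^sup>2 * ((spectral_norm (H - H'))\<^sup>2 + (spectral_norm (H' - B))\<^sup>2))"
proof -
  note invH = coercive_matrix_inv[OF \<open>0 < \<mu>\<close> H] and invB = coercive_matrix_inv[OF \<open>0 < \<mu>\<close> B]
  define N where "N = (\<lambda>z. K *v (matrix_inv B *v z))"
  have N_lin: "N (a + b) = N a + N b" "N (a - b) = N a - N b" for a b
    by (simp_all add: N_def matrix_vector_right_distrib matrix_vector_mult_diff_distrib)
  have "0 \<le> C" using K spectral_norm_nonneg[of K] by linarith
  have N_le: "norm (N z) \<le> C / \<mu> * norm z" for z
  proof -
    have "norm (N z) \<le> C * (norm z / \<mu>)"
      unfolding N_def using norm_mult_vec_le_spectral_norm K invB(3) \<open>0 \<le> C\<close>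
      by (meson mult_mono norm_ge_zero order_trans)
    then show ?thesis by simp
  qed
  have sq: "(norm (X *v p))\<^sup>2 \<le> (norm p)\<^sup>2 * (spectral_norm X)\<^sup>2" for X :: "real^'p^'r"
    using power_mono[OF norm_mult_vec_le_spectral_norm[of X p], of 2]
    by (simp add: power_mult_distrib mult.commute)
  have sqN: "(norm (N (X *v p)))\<^sup>2 \<le> (norm p)\<^sup>2 * ((C / \<mu>)\<^sup>2 * (spectral_norm X)\<^sup>2)" for X :: "real^'p^'p"
  proof -
    have "(norm (N (X *v p)))\<^sup>2 \<le> (C / \<mu>)\<^sup>2 * (norm (X *v p))\<^sup>2"
      using power_mono[OF N_le[of "X *v p"], of 2] by (simp add: power_mult_distrib power_divide)
    also have "\<dots> \<le> (C / \<mu>)\<^sup>2 * ((norm p)\<^sup>2 * (spectral_norm X)\<^sup>2)"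
      by (intro mult_left_mono sq) simp
    finally show ?thesis by (simp add: mult_ac)
  qed
  have "N (B *v p) = K *v p" "N (H *v p) = K *v (matrix_inv B *v q)"
    by (simp_all add: N_def p_def invB invH)
  then have "J *v p - K *v (matrix_inv B *v q)
      = (J - J') *v p + (J' - K) *v p + - N ((H' - B) *v p) + - N ((H - H') *v p)"
    by (simp add: matrix_vector_mult_diff_rdistrib N_lin)
  then have "(norm (J *v p - K *v (matrix_inv B *v q)))\<^sup>2
      \<le> 4 * ((norm ((J - J') *v p))\<^sup>2 + (norm ((J' - K) *v p))\<^sup>2
          + (norm (N ((H' - B) *v p)))\<^sup>2 + (norm (N ((H - H') *v p)))\<^sup>2)"
    using norm_sum4_sq_le by (metis norm_minus_cancel)
  also have "\<dots> \<le> 4 * ((norm p)\<^sup>2 * (spectral_norm (J - J'))\<^sup>2 + (norm p)\<^sup>2 * (spectral_norm (J' - K))\<^sup>2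
      + (norm p)\<^sup>2 * ((C / \<mu>)\<^sup>2 * (spectral_norm (H' - B))\<^sup>2)
      + (norm p)\<^sup>2 * ((C / \<mu>)\<^sup>2 * (spectral_norm (H - H'))\<^sup>2))"
    by (intro mult_left_mono add_mono sq sqN) simp
  finally show ?thesis
    by (simp add: algebra_simps)
qed

theorem lemma5:
  fixes m :: nat
    and f g :: "nat \<Rightarrow> real^'n \<Rightarrow> real^'p \<Rightarrow> real"
    and Lfx Lf\<theta> Cf\<theta> \<mu>g Lg\<theta> Lgx\<theta> Lg\<theta>\<theta> Cgx\<theta> bf bg C1 C2 :: real
    and x :: "real^'n"
  assumes "1 \<le> m"
    and outer: "\<And>i. i \<in> {1..m} \<Longrightarrow> outer_level Lfx Lf\<theta> Cf\<theta> (f i) (g i)"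
    and outer_cross: "\<And>i y. i \<in> {1..m} \<Longrightarrow> Lfx-lipschitz_on UNIV (\<lambda>\<theta>. grad_x (f i) y \<theta>)"
    and inner: "\<And>i. i \<in> {1..m} \<Longrightarrow> inner_level \<mu>g Lg\<theta> Lgx\<theta> Lg\<theta>\<theta> Cgx\<theta> (g i)"
    and heterogeneity: "bounded_heterogeneity m bf bg f g"
    and C1: "C1 = 4 + 4 * (Cgx\<theta>\<^sup>2 / \<mu>g\<^sup>2)"
    and C2: "C2 = 4 * (4 * (Cf\<theta>\<^sup>2 * Cgx\<theta>\<^sup>2 / \<mu>g^4) + 4 * (Cf\<theta>\<^sup>2 / \<mu>g\<^sup>2) + Lfx\<^sup>2 / \<mu>g\<^sup>2
                   + Lf\<theta>\<^sup>2 * Cgx\<theta>\<^sup>2 / \<mu>g^4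
                   + 4 * (Cf\<theta>\<^sup>2 * Cgx\<theta>\<^sup>2 * Lg\<theta>\<theta>\<^sup>2 / \<mu>g^6)
                   + 4 * (Cf\<theta>\<^sup>2 * Lgx\<theta>\<^sup>2 / \<mu>g^4))"
  shows "(\<Sum>i=1..m. (norm (grad (local_obj (f i) (g i)) x - grad (global_obj m f g) x))\<^sup>2)
           \<le> C1 * bf\<^sup>2 + C2 * bg\<^sup>2"
proof -
  let ?I = "{1..m}"
  have I: "finite ?I" "?I \<noteq> {}" and card_I: "card ?I = m" and m_pos: "0 < real m"
    using \<open>1 \<le> m\<close> by auto
  have \<mu>: "0 < \<mu>g"
    using inner[of 1] \<open>1 \<le> m\<close> by (simp add: inner_level_def)
  have sc: "strongly_convex_inner \<mu>g (g i)" if "i \<in> ?I" for i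
    using inner[OF that] unfolding inner_level_def by unfold_locales auto
  define th where "th = (\<lambda>i. inner_sol (g i) x)"
  \<comment> \<open>the common point at which the gradients of the \<open>f i\<close> are compared\<close>
  define tc where "tc = (1 / real m) *\<^sub>R (\<Sum>i=1..m. th i)"
  define J where "J = (\<lambda>i. jac_x\<theta> (g i) x)"
  define H where "H = (\<lambda>i. hess_\<theta>\<theta> (g i) x)"
  define a where "a = (\<lambda>i. grad_x (f i) x)"
  define b where "b = (\<lambda>i. grad_\<theta> (f i) x)"
  define v where "v = (\<lambda>i. hypergradient (f i) (g i) x)"
  \<comment> \<open>\<open>N k\<close> is \<open>J\<^sub>k H\<^sub>k\<^sup>-\<^sup>1\<close> at the minimiser of node \<open>k\<close>; \<open>\<kappa>\<close> bounds its norm\<close>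
  define N where "N = (\<lambda>k q. J k (th k) *v (matrix_inv (H k (th k)) *v q))"
  define w where "w = (\<lambda>k. avg_grad_x m f x tc - N k (avg_grad_\<theta> m f x tc))"
  define \<kappa> where "\<kappa> = Cgx\<theta> / \<mu>g"

  have coercive: "\<mu>g * (norm u)\<^sup>2 \<le> inner u (H i t *v u)" if "i \<in> ?I" for i t u
    unfolding H_def by (rule strongly_convex_inner.hess_coercive[OF sc[OF that]])
  have J_le: "spectral_norm (J i t) \<le> Cgx\<theta>" if "i \<in> ?I" for i t
    using inner[OF that] by (simp add: inner_level_def J_def)
  have J_lip: "(spectral_norm (J i t - J i u))\<^sup>2 \<le> Lgx\<theta>\<^sup>2 * (norm (t - u))\<^sup>2" if "i \<in> ?I" for i t u
  proof -
    have "spectral_norm (jac_x\<theta> (g i) x t - jac_x\<theta> (g i) x u) \<le> Lgx\<theta> * dist (x, t) (x, u)"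
      using inner[OF that] unfolding inner_level_def by blast
    then have "spectral_norm (J i t - J i u) \<le> Lgx\<theta> * norm (t - u)"
      by (simp add: J_def dist_Pair_Pair dist_norm)
    from power_mono[OF this spectral_norm_nonneg, of 2] show ?thesis
      by (simp add: power_mult_distrib)
  qed
  have H_lip: "(spectral_norm (H i t - H i u))\<^sup>2 \<le> Lg\<theta>\<theta>\<^sup>2 * (norm (t - u))\<^sup>2" if "i \<in> ?I" for i t u
  proof -
    have "spectral_norm (hess_\<theta>\<theta> (g i) x t - hess_\<theta>\<theta> (g i) x u) \<le> Lg\<theta>\<theta> * dist (x, t) (x, u)"
      using inner[OF that] unfolding inner_level_def by blast
    then have "spectral_norm (H i t - H i u) \<le> Lg\<theta>\<theta> * norm (t - u)"
      by (simp add: H_def dist_Pair_Pair dist_norm)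
    from power_mono[OF this spectral_norm_nonneg, of 2] show ?thesis
      by (simp add: power_mult_distrib)
  qed
  have a_lip: "(norm (a i t - a i u))\<^sup>2 \<le> Lfx\<^sup>2 * (norm (t - u))\<^sup>2" if "i \<in> ?I" for i t u
    using power_mono[OF lipschitz_onD[OF outer_cross[OF that], of t u x] zero_le_dist, of 2]
    by (simp add: a_def dist_norm power_mult_distrib)
  have b_lip: "(norm (b i t - b i u))\<^sup>2 \<le> Lf\<theta>\<^sup>2 * (norm (t - u))\<^sup>2" if "i \<in> ?I" for i t u
  proof -
    have "Lf\<theta>-lipschitz_on UNIV (\<lambda>\<theta>. grad_\<theta> (f i) x \<theta>)"
      using outer[OF that] by (simp add: outer_level_def)
    from power_mono[OF lipschitz_onD[OF this, of t u] zero_le_dist, of 2] show ?thesis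
      by (simp add: b_def dist_norm power_mult_distrib)
  qed
  have b_le: "norm (b i (th i)) \<le> Cf\<theta>" if "i \<in> ?I" for i
    using outer[OF that] by (simp add: outer_level_def b_def th_def)
  have N_le: "(norm (N k q))\<^sup>2 \<le> \<kappa>\<^sup>2 * (norm q)\<^sup>2" if "k \<in> ?I" for k q
  proof -
    have "norm (N k q) \<le> Cgx\<theta> * (norm q / \<mu>g)"
      unfolding N_def
      using norm_mult_vec_le_spectral_norm[of "J k (th k)"] J_le[OF that] spectral_norm_nonneg
        coercive_matrix_inv(3)[OF \<mu> coercive[OF that]]
      by (meson mult_mono norm_ge_zero order_trans)
    from power_mono[OF this norm_ge_zero, of 2] show ?thesis
      by (simp add: \<kappa>_def power_mult_distrib power_divide)
  qed
  have N_diff: "N k (q - r) = N k q - N k r" for k q r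
    by (simp add: N_def matrix_vector_mult_diff_distrib)

  have v_grad: "GDERIV (local_obj (f i) (g i)) x :> v i" if "i \<in> ?I" for i
    using strongly_convex_inner.GDERIV_local_obj[OF sc[OF that]] outer[OF that]
    by (simp add: v_def outer_level_def)
  have "grad (local_obj (f i) (g i)) x = v i" if "i \<in> ?I" for i
    by (rule grad_eqI[OF v_grad[OF that]])
  moreover have "grad (global_obj m f g) x = (1 / real m) *\<^sub>R (\<Sum>i=1..m. v i)"
    by (intro grad_eqI GDERIV_global_obj v_grad)
  ultimately have LHS: "(\<Sum>i=1..m. (norm (grad (local_obj (f i) (g i)) x - grad (global_obj m f g) x))\<^sup>2)
      = (\<Sum>i=1..m. (norm (v i - (1 / real m) *\<^sub>R (\<Sum>i=1..m. v i)))\<^sup>2)"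
    by simp

  define A where "A = (\<lambda>i. (norm (a i tc - avg_grad_x m f x tc))\<^sup>2)"
  define B where "B = (\<lambda>i. (norm (b i tc - avg_grad_\<theta> m f x tc))\<^sup>2)"
  define \<delta> where "\<delta> = (\<lambda>i. (norm (th i - tc))\<^sup>2)"
  define d where "d = (\<lambda>i k. (norm (th i - th k))\<^sup>2)"
  define j where "j = (\<lambda>i k. (spectral_norm (J i (th k) - J k (th k)))\<^sup>2)"
  define h where "h = (\<lambda>i k. (spectral_norm (H i (th k) - H k (th k)))\<^sup>2)"

  have operator_part: "(norm (N i (b i (th i)) - N k (b i (th i))))\<^sup>2
      \<le> 4 * (Cf\<theta> / \<mu>g)\<^sup>2 * (Lgx\<theta>\<^sup>2 * d i k + j i k + \<kappa>\<^sup>2 * (Lg\<theta>\<theta>\<^sup>2 * d i k + h i k))"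
    if i: "i \<in> ?I" and k: "k \<in> ?I" for i k
  proof -
    define p where "p = matrix_inv (H i (th i)) *v b i (th i)"
    have "norm p \<le> norm (b i (th i)) / \<mu>g"
      unfolding p_def by (rule coercive_matrix_inv(3)[OF \<mu> coercive[OF i]])
    also have "\<dots> \<le> Cf\<theta> / \<mu>g"
      using b_le[OF i] \<mu> by (simp add: divide_right_mono)
    finally have p_le: "(norm p)\<^sup>2 \<le> (Cf\<theta> / \<mu>g)\<^sup>2"
      by (rule power_mono) simp
    have "(norm (N i (b i (th i)) - N k (b i (th i))))\<^sup>2
      \<le> 4 * (norm p)\<^sup>2 * ((spectral_norm (J i (th i) - J i (th k)))\<^sup>2 + j i k
          + \<kappa>\<^sup>2 * ((spectral_norm (H i (th i) - H i (th k)))\<^sup>2 + h i k))"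
      unfolding N_def p_def \<kappa>_def j_def h_def
      by (rule solve_map_difference_sq_le[OF \<mu> coercive[OF i] coercive[OF k] J_le[OF k]])
    also have "\<dots> \<le> 4 * (Cf\<theta> / \<mu>g)\<^sup>2 * (Lgx\<theta>\<^sup>2 * d i k + j i k + \<kappa>\<^sup>2 * (Lg\<theta>\<theta>\<^sup>2 * d i k + h i k))"
      unfolding d_def
      by (intro mult_mono add_mono order_refl mult_nonneg_nonneg add_nonneg_nonneg J_lip[OF i] H_lip[OF i] p_le)
        (auto simp: j_def h_def)
    finally show ?thesis .
  qed

  have pair: "(norm (v i - w k))\<^sup>2 \<le> 4 * ((2 * Lfx\<^sup>2 + 2 * \<kappa>\<^sup>2 * Lf\<theta>\<^sup>2) * \<delta> i + A i + \<kappa>\<^sup>2 * B i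
      + 4 * (Cf\<theta> / \<mu>g)\<^sup>2 * (Lgx\<theta>\<^sup>2 * d i k + j i k + \<kappa>\<^sup>2 * (Lg\<theta>\<theta>\<^sup>2 * d i k + h i k)))"
    if i: "i \<in> ?I" and k: "k \<in> ?I" for i k
  proof -
    \<comment> \<open>the two terms caused by moving from \<open>th i\<close> to \<open>tc\<close>, kept together as one of four\<close>
    define e where "e = (a i (th i) - a i tc) + - N k (b i (th i) - b i tc)"
    have e_le: "(norm e)\<^sup>2 \<le> (2 * Lfx\<^sup>2 + 2 * \<kappa>\<^sup>2 * Lf\<theta>\<^sup>2) * \<delta> i"
    proof -
      have "(norm e)\<^sup>2 \<le> 2 * (norm (a i (th i) - a i tc))\<^sup>2 + 2 * (norm (N k (b i (th i) - b i tc)))\<^sup>2"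
        unfolding e_def using norm_sum2_sq_le by (metis norm_minus_cancel)
      also have "\<dots> \<le> 2 * (Lfx\<^sup>2 * \<delta> i) + 2 * (\<kappa>\<^sup>2 * (Lf\<theta>\<^sup>2 * \<delta> i))"
        unfolding \<delta>_def
        by (intro add_mono mult_left_mono a_lip[OF i] order_trans[OF N_le[OF k]] b_lip[OF i]) auto
      finally show ?thesis by (simp add: algebra_simps)
    qed
    have "v i - w k = e + (a i tc - avg_grad_x m f x tc)
        + - N k (b i tc - avg_grad_\<theta> m f x tc) + - (N i (b i (th i)) - N k (b i (th i)))"
      by (simp add: e_def w_def N_diff v_def hypergradient_def)
        (simp add: N_def a_def b_def J_def H_def th_def)
    then have "(norm (v i - w k))\<^sup>2 \<le> 4 * ((norm e)\<^sup>2 + (norm (a i tc - avg_grad_x m f x tc))\<^sup>2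
        + (norm (N k (b i tc - avg_grad_\<theta> m f x tc)))\<^sup>2 + (norm (N i (b i (th i)) - N k (b i (th i))))\<^sup>2)"
      using norm_sum4_sq_le by (metis norm_minus_cancel)
    also have "\<dots> \<le> 4 * ((2 * Lfx\<^sup>2 + 2 * \<kappa>\<^sup>2 * Lf\<theta>\<^sup>2) * \<delta> i + A i + \<kappa>\<^sup>2 * B i
      + 4 * (Cf\<theta> / \<mu>g)\<^sup>2 * (Lgx\<theta>\<^sup>2 * d i k + j i k + \<kappa>\<^sup>2 * (Lg\<theta>\<theta>\<^sup>2 * d i k + h i k)))"
      unfolding A_def B_def
      by (intro mult_left_mono add_mono e_le order_refl N_le[OF k] operator_part[OF i k]) simp
    finally show ?thesis .
  qed

  have het: "(\<Sum>i=1..m. A i) \<le> bf\<^sup>2" "(\<Sum>i=1..m. B i) \<le> bf\<^sup>2"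
    and het_J: "1 / real m * (\<Sum>i=1..m. \<Sum>k=1..m. j i k) \<le> bg\<^sup>2"
    and het_H: "1 / real m * (\<Sum>i=1..m. \<Sum>k=1..m. h i k) \<le> bg\<^sup>2"
    and het_g: "1 / real m * (\<Sum>i=1..m. \<Sum>k=1..m.
        (norm (grad_\<theta> (g i) x (th k) - grad_\<theta> (g k) x (th k)))\<^sup>2) \<le> bg\<^sup>2"
    using heterogeneity
    unfolding bounded_heterogeneity_def A_def B_def j_def h_def a_def b_def J_def H_def th_def
    by blast+
  \<comment> \<open>the subtracted gradient vanishes; it is kept to match the heterogeneity assumption\<close>
  have d_le: "d i k \<le> (norm (grad_\<theta> (g i) x (th k) - grad_\<theta> (g k) x (th k)))\<^sup>2 / \<mu>g\<^sup>2"
    if "i \<in> ?I" "k \<in> ?I" for i k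
  proof -
    have "norm (th i - th k) \<le> norm (grad_\<theta> (g i) x (th k)) / \<mu>g"
      unfolding th_def by (rule strongly_convex_inner.norm_inner_sol_diff_le[OF sc[OF that(1)]])
    moreover have "grad_\<theta> (g k) x (th k) = 0"
      unfolding th_def by (rule strongly_convex_inner.grad_\<theta>_inner_sol[OF sc[OF that(2)]])
    ultimately have "norm (th i - th k) \<le> norm (grad_\<theta> (g i) x (th k) - grad_\<theta> (g k) x (th k)) / \<mu>g"
      by simp
    from power_mono[OF this norm_ge_zero, of 2] show ?thesis
      by (simp add: d_def power_divide)
  qed
  have "(\<Sum>i=1..m. \<Sum>k=1..m. d i k) \<le> (\<Sum>i=1..m. \<Sum>k=1..m.
      (norm (grad_\<theta> (g i) x (th k) - grad_\<theta> (g k) x (th k)))\<^sup>2 / \<mu>g\<^sup>2)"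
    by (intro sum_mono d_le)
  also have "\<dots> = (\<Sum>i=1..m. \<Sum>k=1..m.
      (norm (grad_\<theta> (g i) x (th k) - grad_\<theta> (g k) x (th k)))\<^sup>2) / \<mu>g\<^sup>2"
    by (simp add: sum_divide_distrib)
  also have "\<dots> \<le> (real m * bg\<^sup>2) / \<mu>g\<^sup>2"
    using het_g m_pos by (intro divide_right_mono) (auto simp: field_simps)
  finally have sum_d: "(\<Sum>i=1..m. \<Sum>k=1..m. d i k) \<le> real m * (bg\<^sup>2 / \<mu>g\<^sup>2)"
    by simp
  have "2 * real m * (\<Sum>i=1..m. \<delta> i) = (\<Sum>i=1..m. \<Sum>k=1..m. d i k)"
    using sum_sq_dist_pairs[OF I, of th] unfolding \<delta>_def d_def tc_def card_I by simp
  \<comment> \<open>the gain of a factor 2 over \<open>sum_d\<close>\<close>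
  with sum_d have sum_\<delta>: "2 * (\<Sum>i=1..m. \<delta> i) \<le> bg\<^sup>2 / \<mu>g\<^sup>2"
    using m_pos by (metis (no_types, lifting) mult.assoc mult.left_commute mult_le_cancel_left_pos)
  have sum_j: "(\<Sum>i=1..m. \<Sum>k=1..m. j i k) \<le> real m * bg\<^sup>2"
    and sum_h: "(\<Sum>i=1..m. \<Sum>k=1..m. h i k) \<le> real m * bg\<^sup>2"
    using het_J het_H m_pos by (auto simp: field_simps)

  \<comment> \<open>the mean of the \<open>v i\<close> is the best reference, so it beats every \<open>w k\<close>\<close>
  have "real m * (\<Sum>i=1..m. (norm (v i - (1 / real m) *\<^sub>R (\<Sum>i=1..m. v i)))\<^sup>2)
      \<le> (\<Sum>k=1..m. \<Sum>i=1..m. (norm (v i - w k))\<^sup>2)"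
    using sum_mono[OF sum_sq_dist_mean_le[OF I, of v], of ?I "\<lambda>k. w k"] by (simp add: card_I)
  also have "\<dots> = (\<Sum>i=1..m. \<Sum>k=1..m. (norm (v i - w k))\<^sup>2)"
    by (rule sum.swap)
  also have "\<dots> \<le> (\<Sum>i=1..m. \<Sum>k=1..m. 4 * ((2 * Lfx\<^sup>2 + 2 * \<kappa>\<^sup>2 * Lf\<theta>\<^sup>2) * \<delta> i + A i + \<kappa>\<^sup>2 * B i
      + 4 * (Cf\<theta> / \<mu>g)\<^sup>2 * (Lgx\<theta>\<^sup>2 * d i k + j i k + \<kappa>\<^sup>2 * (Lg\<theta>\<theta>\<^sup>2 * d i k + h i k))))"
    by (intro sum_mono pair)
  also have "\<dots> = 4 * (real m * ((Lfx\<^sup>2 + \<kappa>\<^sup>2 * Lf\<theta>\<^sup>2) * (2 * (\<Sum>i=1..m. \<delta> i))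
        + (\<Sum>i=1..m. A i) + \<kappa>\<^sup>2 * (\<Sum>i=1..m. B i))
      + 4 * (Cf\<theta> / \<mu>g)\<^sup>2 * (Lgx\<theta>\<^sup>2 * (\<Sum>i=1..m. \<Sum>k=1..m. d i k) + (\<Sum>i=1..m. \<Sum>k=1..m. j i k)
        + \<kappa>\<^sup>2 * (Lg\<theta>\<theta>\<^sup>2 * (\<Sum>i=1..m. \<Sum>k=1..m. d i k) + (\<Sum>i=1..m. \<Sum>k=1..m. h i k))))"
    by (simp add: sum.distrib sum_distrib_left sum_distrib_right algebra_simps)
  also have "\<dots> \<le> 4 * (real m * ((Lfx\<^sup>2 + \<kappa>\<^sup>2 * Lf\<theta>\<^sup>2) * (bg\<^sup>2 / \<mu>g\<^sup>2) + bf\<^sup>2 + \<kappa>\<^sup>2 * bf\<^sup>2)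
      + 4 * (Cf\<theta> / \<mu>g)\<^sup>2 * (Lgx\<theta>\<^sup>2 * (real m * (bg\<^sup>2 / \<mu>g\<^sup>2)) + real m * bg\<^sup>2
        + \<kappa>\<^sup>2 * (Lg\<theta>\<theta>\<^sup>2 * (real m * (bg\<^sup>2 / \<mu>g\<^sup>2)) + real m * bg\<^sup>2)))"
    by (intro mult_left_mono add_mono sum_\<delta> sum_d sum_j sum_h het) auto
  also have "\<dots> = real m * (C1 * bf\<^sup>2 + C2 * bg\<^sup>2)"
    unfolding C1 C2 \<kappa>_def using \<mu>
    by (simp add: power_divide field_simps power2_eq_square eval_nat_numeral)
  finally show ?thesis
    unfolding LHS using m_pos by simp
qed

end
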